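(* Let $\mathbb{H}$ be a real Hilbert space, let $A:\mathbb{H}\rightrightarrows\mathbb{H}$ be maximally monotone, and let $B:\mathbb{H}\to\mathbb{H}$ be monotone and $L$-Lipschitz. Assume that $(A+B)^{-1}(0)\neq\varnothing$, and let $\{(x_k,\lambda_k)\}$ be a sequence generated by the GFRB algorithm with non-decreasing step-size rule (described in the context). Then $(x_k)$ converges weakly to a solution of the inclusion $0\in (A+B)(x)$, i.e. to a point of $(A+B)^{-1}(0)$.
   Context: For a maximally monotone operator $A$ on $\mathbb{H}$ and $\lambda>0$, $J_{\lambda A}:=(I+\lambda A)^{-1}$ denotes the (single-valued) resolvent. $B$ is $L$-Lipschitz if $\|Bx-By\|\le L\|x-y\|$ for all $x,y\in\mathbb{H}$. $(A+B)^{-1}(0)=\{x\in\mathbb{H}:0\in (A+B)(x)\}$. GFRB algorithm with non-decreasing step-size rule. Parameters: $\delta\in\mathbb{R}$, $0\le\alpha<1$, $\varepsilon>0$, and constants $c_1,c_2$ with $0<c_1<c_2<\frac{1-\varepsilon-\alpha}{2|\delta|+2}$; initial points $x_{-1},x_0,x_1\in\mathbb{H}$; initial step-sizes $\lambda_{-1},\lambda_0>0$; and a sequence $(\gamma_k)_{k\ge 0}\subset\mathbb{R}_+$ of nonnegative reals with $\sum_{k=0}^\infty\gamma_k<\infty$. For $k=1,2,\dots$: Step-size update: $$\lambda_k=\begin{cases}\dfrac{c_1\|x_{k-1}-x_k\|}{\|Bx_{k-1}-Bx_k\|}, & \text{if } \|Bx_{k-1}-Bx_k\|>\frac{c_2}{\lambda_{k-1}}\|x_{k-1}-x_k\|,\\[4pt]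 (1+\gamma_{k-1})\lambda_{k-1}, & \text{otherwise.}\end{cases}$$ Iterate update: $$x_{k+1}=J_{\lambda_kA}\Big((1-\alpha)x_k+\alpha x_{k-1}-\lambda_kB(x_k)-\lambda_{k-1}(1+\delta)\big(B(x_k)-B(x_{k-1})\big)+\lambda_{k-2}\delta\big(B(x_{k-1})-B(x_{k-2})\big)\Big).$$ *)

theory Defs
  imports "HOL-Analysis.Analysis"
begin

text \<open>A set-valued operator \<open>T : H \<rightrightarrows> H\<close> is a function \<open>'a \<Rightarrow> 'a set\<close>;
  a single-valued map \<open>B\<close> is identified with the operator \<open>\<lambda>x. {B x}\<close>.\<close>

definition operator_inverse :: "('a \<Rightarrow> 'b set) \<Rightarrow> 'b \<Rightarrow> 'a set" where
  "operator_inverse T y = {x. y \<in> T x}"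

definition operator_sum :: "('a \<Rightarrow> 'b::plus set) \<Rightarrow> ('a \<Rightarrow> 'b set) \<Rightarrow> 'a \<Rightarrow> 'b set" where
  "operator_sum S T x = {u + v | u v. u \<in> S x \<and> v \<in> T x}"

definition operator_scale :: "real \<Rightarrow> ('a \<Rightarrow> 'b::real_vector set) \<Rightarrow> 'a \<Rightarrow> 'b set" where
  "operator_scale c T x = {c *\<^sub>R u | u. u \<in> T x}"

definition monotone_operator :: "('a::real_inner \<Rightarrow> 'a set) \<Rightarrow> bool" where
  "monotone_operator T \<longleftrightarrow>
     (\<forall>x y. \<forall>u\<in>T x. \<forall>v\<in>T y. 0 \<le> (x - y) \<bullet> (u - v))"

definition maximally_monotone :: "('a::real_inner \<Rightarrow> 'a set) \<Rightarrow> bool" where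
  "maximally_monotone T \<longleftrightarrow>
     monotone_operator T \<and>
     (\<forall>S. monotone_operator S \<and> (\<forall>x. T x \<subseteq> S x) \<longrightarrow> S = T)"

text \<open>The resolvent \<open>J\<^sub>T = (I + T)\<^sup>-\<^sup>1\<close> as a function. It is meaningful for maximally
  monotone \<open>T\<close> on a Hilbert space, where \<open>(I + T)\<^sup>-\<^sup>1\<close> takes exactly one value at every
  point (Minty).\<close>

definition resolvent :: "('a::real_inner \<Rightarrow> 'a set) \<Rightarrow> 'a \<Rightarrow> 'a" where
  "resolvent T z = (THE y. y \<in> operator_inverse (operator_sum (\<lambda>x. {x}) T) z)"

definition weakly_converges_to :: "(nat \<Rightarrow> 'a::real_inner) \<Rightarrow> 'a \<Rightarrow> bool" where
  "weakly_converges_to X p \<longleftrightarrow> (\<forall>y. (\<lambda>n. X n \<bullet> y) \<longlonglongrightarrow> p \<bullet> y)"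

text \<open>The sequences are indexed by integers because the algorithm is initialised with
  \<open>x (-1), x 0, x 1\<close> and \<open>s (-1), s 0\<close>; values at indices below \<open>-1\<close> are
  irrelevant. The step-sizes are called \<open>s\<close>.\<close>

definition gfrb_step_sizes ::
  "('a::real_inner \<Rightarrow> 'a) \<Rightarrow> real \<Rightarrow> real \<Rightarrow> (nat \<Rightarrow> real) \<Rightarrow> (int \<Rightarrow> 'a) \<Rightarrow> (int \<Rightarrow> real) \<Rightarrow> bool" where
  "gfrb_step_sizes B c1 c2 \<gamma> x s \<longleftrightarrow>
     (\<forall>k::int. k \<ge> 1 \<longrightarrow>
        s k = (if norm (B (x (k - 1)) - B (x k)) > c2 / s (k - 1) * norm (x (k - 1) - x k)
               then c1 * norm (x (k - 1) - x k) / norm (B (x (k - 1)) - B (x k))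
               else (1 + \<gamma> (nat (k - 1))) * s (k - 1)))"

definition gfrb_iterates ::
  "('a::real_inner \<Rightarrow> 'a set) \<Rightarrow> ('a \<Rightarrow> 'a) \<Rightarrow> real \<Rightarrow> real \<Rightarrow> (int \<Rightarrow> 'a) \<Rightarrow> (int \<Rightarrow> real) \<Rightarrow> bool" where
  "gfrb_iterates A B \<alpha> \<delta> x s \<longleftrightarrow>
     (\<forall>k::int. k \<ge> 1 \<longrightarrow>
        x (k + 1) = resolvent (operator_scale (s k) A)
          ((1 - \<alpha>) *\<^sub>R x k + \<alpha> *\<^sub>R x (k - 1)
           - s k *\<^sub>R B (x k)
           - (s (k - 1) * (1 + \<delta>)) *\<^sub>R (B (x k) - B (x (k - 1)))
           + (s (k - 2) * \<delta>) *\<^sub>R (B (x (k - 1)) - B (x (k - 2)))))"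

end

theory Submission
  imports Defs
begin

text \<open>
  Write \<open>d\<^sub>k = x\<^sub>k - x\<^sub>k\<^sub>-\<^sub>1\<close>, \<open>w\<^sub>k = \<lambda>\<^sub>k\<^sub>-\<^sub>1 (B x\<^sub>k - B x\<^sub>k\<^sub>-\<^sub>1)\<close> and \<open>u\<^sub>k = w\<^sub>k - \<delta> w\<^sub>k\<^sub>-\<^sub>1\<close>. The forcing terms of the
  iteration telescope to \<open>u\<^sub>k\<^sub>+\<^sub>1 - u\<^sub>k\<close>. The reduction of the step size happens only finitely often,
  since each time it multiplies the step size by at most \<open>c\<^sub>1 / c\<^sub>2 < 1\<close> while the step sizes stay
  bounded below and the product of the factors \<open>1 + \<gamma>\<^sub>k\<close> converges; hence eventually
  \<open>\<parallel>w\<^sub>k\<parallel> \<le> c\<^sub>2 \<parallel>d\<^sub>k\<parallel>\<close>. From then on, for every zero \<open>p\<close> of \<open>A + B\<close>, the Lyapunov function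
  \<open>\<parallel>x\<^sub>k - p\<parallel>\<^sup>2 + \<alpha> \<parallel>x\<^sub>k\<^sub>-\<^sub>1 - p\<parallel>\<^sup>2 - 2 \<langle>x\<^sub>k - p, u\<^sub>k\<rangle> + c\<^sub>2 (1 + \<bar>\<delta>\<bar>) \<parallel>d\<^sub>k\<parallel>\<^sup>2 + c\<^sub>2 \<bar>\<delta>\<bar> \<parallel>d\<^sub>k\<^sub>-\<^sub>1\<parallel>\<^sup>2\<close>
  is nonnegative and decreases by at least \<open>\<epsilon> \<parallel>d\<^sub>k\<^sub>+\<^sub>1\<parallel>\<^sup>2\<close>. So \<open>d\<^sub>k \<rightarrow> 0\<close> and \<open>\<parallel>x\<^sub>k - p\<parallel>\<close> converges,
  and an argument of Opial type gives weak convergence.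

  Weak compactness is replaced by the fact that a decreasing sequence of nonempty bounded closed
  convex sets has a common point. Applied to the closed convex hulls of the tails of a bounded
  sequence it yields a substitute for a weak cluster point, and applied to sublevel sets of the
  Fitzpatrick function it yields Minty's theorem, on which the meaning of the resolvent rests.
\<close>

subsection \<open>Convexity in Hilbert spaces and Minty's theorem\<close>

lemma maximally_monotone_iff:
  "maximally_monotone T \<longleftrightarrow>
     (\<forall>x u. u \<in> T x \<longleftrightarrow> (\<forall>y. \<forall>v\<in>T y. 0 \<le> (x - y) \<bullet> (u - v)))"
proof
  assume max: "maximally_monotone T"
  have mono: "0 \<le> (x - y) \<bullet> (u - v)" if "u \<in> T x" "v \<in> T y" for x y u v
    using max that unfolding maximally_monotone_def monotone_operator_def by blast
  have "u \<in> T x" if rel: "\<And>y v. v \<in> T y \<Longrightarrow> 0 \<le> (x - y) \<bullet> (u - v)" for x u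
  proof -
    define S where "S = T(x := insert u (T x))"
    have swap: "(y - x) \<bullet> (v - u) = (x - y) \<bullet> (u - v)" for y v
      by (simp add: algebra_simps)
    have "monotone_operator S"
      unfolding monotone_operator_def S_def using mono rel
      by (auto simp: swap split: if_splits)
    moreover have "\<forall>y. T y \<subseteq> S y" by (auto simp: S_def)
    ultimately have "S = T" using max unfolding maximally_monotone_def by blast
    thus ?thesis by (metis S_def fun_upd_same insertI1)
  qed
  thus "\<forall>x u. u \<in> T x \<longleftrightarrow> (\<forall>y. \<forall>v\<in>T y. 0 \<le> (x - y) \<bullet> (u - v))"
    using mono by blast
next
  assume iff: "\<forall>x u. u \<in> T x \<longleftrightarrow> (\<forall>y. \<forall>v\<in>T y. 0 \<le> (x - y) \<bullet> (u - v))"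
  have "S = T" if S: "monotone_operator S" "\<forall>x. T x \<subseteq> S x" for S
  proof
    fix x
    have "S x \<subseteq> T x"
      using S iff unfolding monotone_operator_def by blast
    thus "S x = T x" using S(2) by blast
  qed
  moreover have "monotone_operator T"
    using iff unfolding monotone_operator_def by blast
  ultimately show "maximally_monotone T"
    unfolding maximally_monotone_def by blast
qed

lemma maximally_monotone_affine:
  fixes A :: "'a::real_inner \<Rightarrow> 'a set"
  assumes "maximally_monotone A" "r > 0"
  shows "maximally_monotone (\<lambda>x. (\<lambda>a. r *\<^sub>R a - z) ` A x)"
  unfolding maximally_monotone_iff
proof (intro allI)
  fix x u
  define u' where "u' = (1 / r) *\<^sub>R (u + z)"
  have u: "u = r *\<^sub>R u' - z" using assms(2) by (simp add: u'_def)
  have "u \<in> (\<lambda>a. r *\<^sub>R a - z) ` A x \<longleftrightarrow> u' \<in> A x"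
    using assms(2) by (auto simp: u)
  also have "\<dots> \<longleftrightarrow> (\<forall>y. \<forall>v\<in>A y. 0 \<le> (x - y) \<bullet> (u' - v))"
    using assms(1) unfolding maximally_monotone_iff by blast
  also have "\<dots> \<longleftrightarrow> (\<forall>y. \<forall>v\<in>(\<lambda>a. r *\<^sub>R a - z) ` A y. 0 \<le> (x - y) \<bullet> (u - v))"
  proof -
    have "(x - y) \<bullet> (u - (r *\<^sub>R v - z)) = r * ((x - y) \<bullet> (u' - v))" for y v
      by (simp add: u algebra_simps)
    thus ?thesis using assms(2) by (simp add: zero_le_mult_iff)
  qed
  finally show "u \<in> (\<lambda>a. r *\<^sub>R a - z) ` A x \<longleftrightarrow>
    (\<forall>y. \<forall>v\<in>(\<lambda>a. r *\<^sub>R a - z) ` A y. 0 \<le> (x - y) \<bullet> (u - v))" .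
qed

lemma nested_closed_convex_nonempty:
  fixes K :: "nat \<Rightarrow> 'a::{real_inner, complete_space} set"
  assumes closed: "\<And>n. closed (K n)" and convex: "\<And>n. convex (K n)"
    and ne: "\<And>n. K n \<noteq> {}" and dec: "decseq K" and bounded: "bounded (K 0)"
  shows "\<exists>c. \<forall>n. c \<in> K n"
proof -
  define m where "m n = (INF z\<in>K n. (norm z)\<^sup>2)" for n
  have bdd: "bdd_below ((\<lambda>z. (norm z)\<^sup>2) ` K n)" for n
    by (rule bdd_belowI2[of _ 0]) simp
  have m_le: "m n \<le> (norm z)\<^sup>2" if "z \<in> K n" for n z
    unfolding m_def by (rule cINF_lower[OF bdd that])
  have sub: "K j \<subseteq> K i" if "i \<le> j" for i j
    using dec that by (simp add: decseq_def)
  have "\<exists>z\<in>K n. (norm z)\<^sup>2 < m n + 1 / Suc n" for n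
    using cINF_less_iff[OF ne bdd, of n "m n + 1 / Suc n"] by (simp add: m_def)
  then obtain z where z: "\<And>n. z n \<in> K n" "\<And>n. (norm (z n))\<^sup>2 < m n + 1 / Suc n"
    by metis
  have inc: "incseq m"
    unfolding incseq_def m_def using sub by (auto intro!: cINF_superset_mono ne bdd)
  obtain R where R: "\<And>w. w \<in> K 0 \<Longrightarrow> norm w \<le> R"
    using bounded unfolding bounded_iff by blast
  have "m n \<le> R\<^sup>2" for n
    using m_le[OF z(1)] R[of "z n"] sub[of 0 n] z(1)[of n]
    by (meson le0 norm_ge_zero order_trans power_mono subsetD)
  hence "convergent m"
    using incseq_convergent[OF inc] convergentI by metis
  hence Cm: "Cauchy m" by (rule convergent_Cauchy)
  have dist_bound: "(dist (z i) (z j))\<^sup>2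
      \<le> 2 * ((m i + 1 / Suc i) - m i) + 2 * ((m j + 1 / Suc j) - m i)" if "i \<le> j" for i j
  proof -
    have "(1/2) *\<^sub>R z i + (1/2) *\<^sub>R z j \<in> K i"
      using convexD[OF convex z(1)[of i] subsetD[OF sub[OF that] z(1)[of j]], of "1/2" "1/2"] by simp
    hence "m i \<le> (norm ((1/2) *\<^sub>R z i + (1/2) *\<^sub>R z j))\<^sup>2" by (rule m_le)
    also have "\<dots> = (2 * (norm (z i))\<^sup>2 + 2 * (norm (z j))\<^sup>2 - (dist (z i) (z j))\<^sup>2) / 4"
      by (simp add: power2_norm_eq_inner dist_norm algebra_simps inner_commute)
    finally show ?thesis using z(2)[of i] z(2)[of j] by argo
  qed
  have "Cauchy z"
  proof (rule metric_CauchyI)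
    fix e :: real assume e: "0 < e"
    have "(\<lambda>n. 1 / real (Suc n)) \<longlonglongrightarrow> 0"
      using LIMSEQ_inverse_real_of_nat by (simp add: inverse_eq_divide)
    then obtain N1 where N1: "\<And>n. n \<ge> N1 \<Longrightarrow> 1 / real (Suc n) < e\<^sup>2 / 8"
      using e order_tendstoD(2)[of "\<lambda>n. 1 / real (Suc n)" 0 sequentially "e\<^sup>2/8"]
      unfolding eventually_sequentially by auto
    obtain N2 where N2: "\<And>i j. i \<ge> N2 \<Longrightarrow> j \<ge> N2 \<Longrightarrow> dist (m i) (m j) < e\<^sup>2 / 8"
      using metric_CauchyD[OF Cm, of "e\<^sup>2/8"] e by auto
    have *: "dist (z i) (z j) < e" if "i \<ge> max N1 N2" "i \<le> j" for i j
    proof -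
      have "\<bar>m j - m i\<bar> < e\<^sup>2/8" using N2[of j i] that by (simp add: dist_real_def)
      moreover have "1 / real (Suc i) < e\<^sup>2 / 8"
        by (rule N1) (use that in simp)
      moreover have "1 / real (Suc j) < e\<^sup>2 / 8"
        by (rule N1) (use that in simp)
      ultimately have "(dist (z i) (z j))\<^sup>2 < e\<^sup>2"
        using dist_bound[OF that(2)] by argo
      thus ?thesis using e by (simp add: power2_less_imp_less)
    qed
    show "\<exists>M. \<forall>i\<ge>M. \<forall>j\<ge>M. dist (z i) (z j) < e"
      using * by (metis dist_commute nle_le)
  qed
  then obtain c where c: "z \<longlonglongrightarrow> c" using Cauchy_convergent convergent_def by blast
  have "c \<in> K n" for n
  proof (rule closed_sequentially[OF closed, of "\<lambda>i. z (i + n)"])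
    show "z (i + n) \<in> K n" for i using z(1) sub[of n "i + n"] by auto
    show "(\<lambda>i. z (i + n)) \<longlonglongrightarrow> c" using c by (rule LIMSEQ_ignore_initial_segment)
  qed
  thus ?thesis by blast
qed

text \<open>The points \<open>c\<close> provided here need not be weak cluster points, because the indices may depend on
  the single direction \<open>y\<close>; this suffices for the demiclosedness and uniqueness arguments below.\<close>

lemma bounded_weak_cluster_point:
  fixes X :: "nat \<Rightarrow> 'a::{real_inner, complete_space}"
  assumes "bounded (range X)"
  shows "\<exists>c. \<forall>y. \<forall>e>0. \<exists>\<^sub>F n in sequentially. (X n - c) \<bullet> y < e"
proof -
  define K where "K n = closure (convex hull (X ` {n..}))" for n
  have "\<exists>c. \<forall>n. c \<in> K n"
  proof (rule nested_closed_convex_nonempty)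
    show "decseq K" unfolding K_def decseq_def
      by (auto intro!: closure_mono hull_mono image_mono)
    have "bounded (X ` {0..})" using assms by (rule bounded_subset) auto
    thus "bounded (K 0)" unfolding K_def
      by (intro bounded_closure bounded_convex_hull)
  qed (auto simp: K_def intro: convex_closure)
  then obtain c where c: "\<And>n. c \<in> K n" by blast
  have "\<exists>\<^sub>F n in sequentially. (X n - c) \<bullet> y < e" if "e > 0" for y e
  proof (rule ccontr)
    assume "\<not> ?thesis"
    then obtain N where N: "\<And>n. n \<ge> N \<Longrightarrow> (X n - c) \<bullet> y \<ge> e"
      unfolding not_frequently eventually_sequentially by force
    have "K N \<subseteq> {w. y \<bullet> w \<ge> e + y \<bullet> c}"
      unfolding K_def
    proof (intro closure_minimal hull_minimal closed_halfspace_ge convex_halfspace_ge)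
      show "X ` {N..} \<subseteq> {w. y \<bullet> w \<ge> e + y \<bullet> c}"
        using N by (auto simp: inner_diff_left inner_commute[of y] le_diff_eq)
    qed
    thus False using c[of N] that by auto
  qed
  thus ?thesis by blast
qed

lemma sq_norm_ball:
  fixes a :: "'a::real_inner"
  shows "{z. (norm (z - a))\<^sup>2 \<le> \<rho>} = (if \<rho> < 0 then {} else cball a (sqrt \<rho>))"
proof (cases "\<rho> < 0")
  case True
  have "\<not> (norm (z - a))\<^sup>2 \<le> \<rho>" for z
    using True zero_le_power2[of "norm (z - a)"] by linarith
  thus ?thesis using True by simp
next
  case False
  have "(norm (z - a))\<^sup>2 \<le> \<rho> \<longleftrightarrow> norm (z - a) \<le> sqrt \<rho>" for z
    using real_sqrt_le_iff[of "(norm (z - a))\<^sup>2" \<rho>] by simp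
  thus ?thesis using False by (simp add: set_eq_iff dist_norm norm_minus_commute)
qed

text \<open>In the proof, \<open>f\<close> is \<open>\<langle>x, u\<rangle> + \<parallel>(x, u)\<parallel>\<^sup>2 / 2\<close>, the supremum of \<open>q z\<close> over the graph \<open>G\<close> is the
  Fitzpatrick function of \<open>T\<close> plus \<open>\<parallel>z\<parallel>\<^sup>2 / 2\<close>, and \<open>C r\<close> are its sublevel sets. Its minimiser \<open>(x, u)\<close>
  turns out to satisfy \<open>u = - x\<close> and \<open>u \<in> T x\<close>.\<close>

lemma minty_zero:
  fixes T :: "'a::{real_inner, complete_space} \<Rightarrow> 'a set"
  assumes max: "maximally_monotone T"
  shows "\<exists>x. - x \<in> T x"
proof -
  define G where "G = {w. snd w \<in> T (fst w)}"
  define q where "q z w = z \<bullet> (snd w, fst w) - fst w \<bullet> snd w + (norm z)\<^sup>2 / 2"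
    for z w :: "'a \<times> 'a"
  define f where "f z = fst z \<bullet> snd z + (norm z)\<^sup>2 / 2" for z :: "'a \<times> 'a"
  define C where "C r = {z. \<forall>w\<in>G. q z w \<le> r}" for r
  have mono: "(fst z - fst w) \<bullet> (snd z - snd w) \<ge> 0" if "z \<in> G" "w \<in> G" for z w
    using max that unfolding maximally_monotone_def monotone_operator_def G_def by blast
  have f_ge: "0 \<le> f z" for z
  proof -
    have "2 * f z = (norm (fst z + snd z))\<^sup>2"
      by (cases z) (simp add: f_def power2_norm_eq_inner algebra_simps inner_commute)
    thus ?thesis using zero_le_power2[of "norm (fst z + snd z)"] by linarith
  qed
  have q_eq: "q z w = f z - (fst z - fst w) \<bullet> (snd z - snd w)" for z w
    by (cases z; cases w) (simp add: q_def f_def algebra_simps inner_commute)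
  have f_le_q: "\<exists>w\<in>G. f z \<le> q z w" for z
  proof (cases "z \<in> G")
    case True
    thus ?thesis by (intro bexI[of _ z]) (simp_all add: q_eq)
  next
    case False
    hence "snd z \<notin> T (fst z)" by (simp add: G_def)
    hence "\<not> (\<forall>y. \<forall>v\<in>T y. 0 \<le> (fst z - y) \<bullet> (snd z - v))"
      using max[unfolded maximally_monotone_iff] by blast
    then obtain y v where "v \<in> T y" "(fst z - y) \<bullet> (snd z - v) < 0"
      unfolding not_le[symmetric] by blast
    thus ?thesis by (intro bexI[of _ "(y, v)"]) (simp_all add: q_eq G_def)
  qed
  hence C_f: "f z \<le> r" if "z \<in> C r" for z r
  proof -
    obtain w where "w \<in> G" "f z \<le> q z w" using f_le_q by blast
    thus ?thesis using that by (auto simp: C_def intro: order_trans)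
  qed
  have G_C: "z \<in> C (f z)" if "z \<in> G" for z
    using mono[OF that] by (auto simp: C_def q_eq)
  obtain w0 where w0: "w0 \<in> G" using f_le_q by blast
  have "(norm (z - (- (snd w, fst w))))\<^sup>2 = 2 * q z w + (norm w)\<^sup>2 + 2 * (fst w \<bullet> snd w)" for z w
    by (cases z; cases w) (simp add: q_def power2_norm_eq_inner algebra_simps inner_commute)
  hence ball: "{z. q z w \<le> r} =
      {z. (norm (z - (- (snd w, fst w))))\<^sup>2 \<le> 2 * r + (norm w)\<^sup>2 + 2 * (fst w \<bullet> snd w)}" for w r
    by auto
  have C_Inter: "C r = (\<Inter>w\<in>G. {z. q z w \<le> r})" for r
    by (auto simp: C_def)
  have C_closed: "closed (C r)" and C_convex: "convex (C r)" for r
    unfolding C_Inter ball sq_norm_ball by (intro closed_INT convex_INT; simp)+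
  have C_bounded: "bounded (C r)" for r
  proof (rule bounded_subset)
    show "bounded {z. q z w0 \<le> r}" unfolding ball sq_norm_ball by auto
    show "C r \<subseteq> {z. q z w0 \<le> r}" using w0 by (auto simp: C_def)
  qed
  have C_mono: "C r \<subseteq> C r'" if "r \<le> r'" for r r'
    using that by (force simp: C_def)
  define m where "m = Inf {r. C r \<noteq> {}}"
  have bdd: "bdd_below {r. C r \<noteq> {}}"
    using C_f f_ge by (intro bdd_belowI[of _ 0]) (blast intro: order_trans)
  have m_le: "m \<le> r" if "z \<in> C r" for z r
    unfolding m_def by (rule cInf_lower[OF _ bdd]) (use that in auto)
  have m_ne: "C r \<noteq> {}" if "m < r" for r
  proof -
    have "{r. C r \<noteq> {}} \<noteq> {}" using G_C[OF w0] by blast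
    hence "\<exists>r'\<in>{r. C r \<noteq> {}}. r' < r"
      using that cInf_less_iff[OF _ bdd] unfolding m_def by blast
    then obtain r' where "C r' \<noteq> {}" "r' < r" by blast
    thus ?thesis using C_mono[of r' r] by auto
  qed
  have "\<exists>c. \<forall>n. c \<in> C (m + 1 / Suc n)"
  proof (rule nested_closed_convex_nonempty[OF C_closed C_convex _ _ C_bounded])
    show "C (m + 1 / Suc n) \<noteq> {}" for n by (rule m_ne) simp
    show "decseq (\<lambda>n. C (m + 1 / Suc n))"
      unfolding decseq_def by (intro allI impI C_mono) (simp add: frac_le)
  qed
  then obtain z0 where z0: "\<And>n. z0 \<in> C (m + 1 / Suc n)" by blast
  have z0m: "z0 \<in> C m"
    unfolding C_def
  proof (intro CollectI ballI)
    fix w assume "w \<in> G"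
    hence "q z0 w \<le> m + inverse (real (Suc n))" for n
      using z0[of n] by (auto simp: C_def inverse_eq_divide)
    thus "q z0 w \<le> m"
      by (intro LIMSEQ_le_const[OF LIMSEQ_inverse_real_of_nat_add]) auto
  qed
  have var: "m + (norm (z - z0))\<^sup>2 / 2 \<le> f z" if "z \<in> G" for z
  proof -
    have *: "m + (1 - t) * ((norm (z - z0))\<^sup>2 / 2) \<le> f z" if t: "0 < t" "t < 1" for t :: real
    proof -
      let ?r = "(1 - t) * m + t * f z - t * (1 - t) * ((norm (z - z0))\<^sup>2 / 2)"
      have "(1 - t) *\<^sub>R z0 + t *\<^sub>R z \<in> C ?r"
        unfolding C_def
      proof (intro CollectI ballI)
        fix w assume w: "w \<in> G"
        have "q ((1 - t) *\<^sub>R z0 + t *\<^sub>R z) w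
            = (1 - t) * q z0 w + t * q z w - t * (1 - t) * ((norm (z - z0))\<^sup>2 / 2)"
          unfolding q_def power2_norm_eq_inner
          by (simp add: inner_commute algebra_simps add_divide_distrib diff_divide_distrib)
        moreover have "q z0 w \<le> m" "q z w \<le> f z"
          using w z0m G_C[OF \<open>z \<in> G\<close>] by (auto simp: C_def)
        ultimately show "q ((1 - t) *\<^sub>R z0 + t *\<^sub>R z) w \<le> ?r"
          using t by (smt (verit) mult_left_mono)
      qed
      hence "m \<le> ?r" by (rule m_le)
      hence "t * (m + (1 - t) * ((norm (z - z0))\<^sup>2 / 2)) \<le> t * f z"
        by (simp add: algebra_simps)
      thus ?thesis using t by simp
    qed
    have "((\<lambda>t. m + (1 - t) * ((norm (z - z0))\<^sup>2 / 2)) \<longlongrightarrow> m + (1 - 0) * ((norm (z - z0))\<^sup>2 / 2))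
        (at_right (0::real))"
      by (intro tendsto_intros)
    moreover have "eventually (\<lambda>t. m + (1 - t) * ((norm (z - z0))\<^sup>2 / 2) \<le> f z) (at_right (0::real))"
      using * by (auto simp: eventually_at_right[of 0 1] intro!: exI[of _ 1])
    ultimately show ?thesis
      using tendsto_upperbound by fastforce
  qed
  define x u where "x = fst z0" and "u = snd z0"
  have z0_eq: "z0 = (x, u)" by (simp add: x_def u_def)
  have key: "(norm (x + u))\<^sup>2 \<le> (- u - y) \<bullet> (- x - v)" if "v \<in> T y" for y v
  proof -
    have "f z0 + (norm ((y, v) - z0))\<^sup>2 / 2 \<le> f (y, v)"
      using var[of "(y, v)"] C_f[OF z0m] that by (simp add: G_def)
    thus ?thesis
      by (simp add: z0_eq f_def power2_norm_eq_inner algebra_simps inner_commute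
          add_divide_distrib diff_divide_distrib)
  qed
  have "- x \<in> T (- u)"
    using max key unfolding maximally_monotone_iff
    by (meson order_trans zero_le_power2)
  moreover from key[OF this] have "x + u = 0" by simp
  hence "u = - x" by (simp add: add_eq_0_iff)
  ultimately show ?thesis by auto
qed

theorem minty:
  fixes A :: "'a::{real_inner, complete_space} \<Rightarrow> 'a set"
  assumes "maximally_monotone A" "r > 0"
  obtains y a where "a \<in> A y" "y + r *\<^sub>R a = z"
proof -
  obtain y where "- y \<in> (\<lambda>a. r *\<^sub>R a - z) ` A y"
    using minty_zero[OF maximally_monotone_affine[OF assms]] by blast
  then obtain a where "a \<in> A y" "- y = r *\<^sub>R a - z" by blast
  thus ?thesis using that by (metis add.commute add_diff_cancel_left' diff_eq_eq uminus_add_conv_diff)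
qed

lemma resolvent_nonexpansive:
  assumes "monotone_operator A" "r > 0" "a \<in> A y" "b \<in> A w"
  shows "norm (y - w) \<le> norm ((y + r *\<^sub>R a) - (w + r *\<^sub>R b))"
proof (cases "y = w")
  case False
  have "0 \<le> (y - w) \<bullet> (a - b)"
    using assms unfolding monotone_operator_def by blast
  hence "(y - w) \<bullet> (y - w) \<le> (y - w) \<bullet> ((y + r *\<^sub>R a) - (w + r *\<^sub>R b))"
    using assms(2) by (simp add: algebra_simps) (metis distrib_left mult_left_mono less_imp_le)
  also have "\<dots> \<le> norm (y - w) * norm ((y + r *\<^sub>R a) - (w + r *\<^sub>R b))"
    by (rule norm_cauchy_schwarz)
  finally show ?thesis using False
    by (simp add: power2_norm_eq_inner[symmetric] power2_eq_square)
qed simp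

lemma resolvent_scale:
  fixes A :: "'a::{real_inner, complete_space} \<Rightarrow> 'a set"
  assumes max: "maximally_monotone A" and r: "r > 0"
  shows "\<exists>a\<in>A (resolvent (operator_scale r A) z). resolvent (operator_scale r A) z + r *\<^sub>R a = z"
proof -
  have mem: "y \<in> operator_inverse (operator_sum (\<lambda>x. {x}) (operator_scale r A)) z
      \<longleftrightarrow> (\<exists>a\<in>A y. y + r *\<^sub>R a = z)" for y
    by (auto simp: operator_inverse_def operator_sum_def operator_scale_def)
  have mono: "monotone_operator A" using max by (simp add: maximally_monotone_def)
  obtain y a where ya: "a \<in> A y" "y + r *\<^sub>R a = z" using minty[OF max r] .
  have "resolvent (operator_scale r A) z = y"
    unfolding resolvent_def mem
  proof (rule the_equality)
    show "\<exists>a\<in>A y. y + r *\<^sub>R a = z" using ya by blast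
    fix w assume "\<exists>b\<in>A w. w + r *\<^sub>R b = z"
    then obtain b where b: "b \<in> A w" "w + r *\<^sub>R b = z" by blast
    show "w = y" using resolvent_nonexpansive[OF mono r ya(1) b(1)] unfolding ya(2) b(2) by simp
  qed
  thus ?thesis using ya by blast
qed

lemma resolvent_sum_exists:
  fixes A :: "'a::{real_inner, complete_space} \<Rightarrow> 'a set"
  assumes max: "maximally_monotone A" and B: "L-lipschitz_on UNIV B"
    and r: "r > 0" "r * L < 1"
  shows "\<exists>y. \<exists>a\<in>A y. y + r *\<^sub>R (a + B y) = z"
proof -
  have mono: "monotone_operator A" using max by (simp add: maximally_monotone_def)
  define J where "J = resolvent (operator_scale r A)"
  define F where "F y = J (z - r *\<^sub>R B y)" for y
  have J: "\<exists>a\<in>A (J w). J w + r *\<^sub>R a = w" for w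
    unfolding J_def by (rule resolvent_scale[OF max r(1)])
  have "\<exists>!y\<in>UNIV. F y = y"
  proof (rule Banach_fix)
    show "0 \<le> r * L" using lipschitz_on_nonneg[OF B] r(1) by simp
    fix y w
    have "norm (J u - J v) \<le> norm (u - v)" for u v
      using J[of u] J[of v] resolvent_nonexpansive[OF mono r(1)] by metis
    from this[of "z - r *\<^sub>R B y" "z - r *\<^sub>R B w"]
    have "dist (F y) (F w) \<le> norm (r *\<^sub>R (B w - B y))"
      by (simp add: F_def dist_norm scaleR_right_diff_distrib)
    also have "\<dots> \<le> r * L * dist y w"
      using lipschitz_onD[OF B, of w y] r(1) by (simp add: dist_norm norm_minus_commute)
    finally show "dist (F y) (F w) \<le> r * L * dist y w" .
  qed (use r complete_UNIV in auto)
  then obtain y where "J (z - r *\<^sub>R B y) = y" unfolding F_def by blast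
  then obtain a where "a \<in> A y" "y + r *\<^sub>R a = z - r *\<^sub>R B y" using J by metis
  thus ?thesis by (intro exI[of _ y] bexI[of _ a]) (auto simp: algebra_simps)
qed

subsection \<open>Weak convergence to a zero of the sum\<close>

lemma tendsto_inner_bounded_zero:
  fixes X W :: "nat \<Rightarrow> 'a::real_inner"
  assumes "bounded (range X)" "W \<longlonglongrightarrow> 0"
  shows "(\<lambda>n. X n \<bullet> W n) \<longlonglongrightarrow> 0"
proof -
  obtain R where R: "\<And>n. norm (X n) \<le> R"
    using assms(1) unfolding bounded_iff by auto
  show ?thesis
  proof (rule Lim_null_comparison)
    show "\<forall>\<^sub>F n in sequentially. norm (X n \<bullet> W n) \<le> R * norm (W n)"
      using R by (intro always_eventually allI order_trans[OF Cauchy_Schwarz_ineq2[folded real_norm_def]])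
        (auto intro: mult_right_mono)
    show "(\<lambda>n. R * norm (W n)) \<longlonglongrightarrow> 0"
      using tendsto_mult_left[OF tendsto_norm_zero[OF assms(2)], of R] by simp
  qed
qed

lemma zero_cluster_point:
  fixes A :: "'a::{real_inner, complete_space} \<Rightarrow> 'a set"
  assumes max: "maximally_monotone A" and mono_B: "monotone_operator (\<lambda>z. {B z})"
    and lip: "L-lipschitz_on UNIV B"
    and incl: "\<And>n. g n - B (X n) \<in> A (X n)" and g: "g \<longlonglongrightarrow> 0" and bounded: "bounded (range X)"
  shows "\<exists>c. - B c \<in> A c \<and> (\<forall>y. \<forall>e>0. \<exists>\<^sub>F n in sequentially. (X n - c) \<bullet> y < e)"
proof -
  obtain c where c: "\<And>y e. e > 0 \<Longrightarrow> \<exists>\<^sub>F n in sequentially. (X n - c) \<bullet> y < e"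
    using bounded_weak_cluster_point[OF bounded] by blast
  define r where "r = 1 / (L + 1)"
  have L: "L \<ge> 0" using lip by (rule lipschitz_on_nonneg)
  have r: "r > 0" "r * L < 1" using L by (auto simp: r_def field_simps)
  obtain y a where a: "a \<in> A y" and ya: "y + r *\<^sub>R (a + B y) = c"
    using resolvent_sum_exists[OF max lip r] by blast
  have ineq: "(norm (c - y))\<^sup>2 \<le> (X n - c) \<bullet> (y - c) + r * ((X n - y) \<bullet> g n)" for n
  proof -
    have "0 \<le> (X n - y) \<bullet> (g n - B (X n) - a)"
      using max incl[of n] a unfolding maximally_monotone_def monotone_operator_def by blast
    moreover have "0 \<le> (X n - y) \<bullet> (B (X n) - B y)"
      using mono_B unfolding monotone_operator_def by blast
    ultimately have "0 \<le> (X n - y) \<bullet> (g n - (a + B y))"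
      by (simp add: algebra_simps)
    hence "0 \<le> r * ((X n - y) \<bullet> (g n - (a + B y)))" using r(1) by simp
    also have "\<dots> = r * ((X n - y) \<bullet> g n) - (X n - y) \<bullet> (r *\<^sub>R (a + B y))"
      by (simp add: algebra_simps)
    also have "r *\<^sub>R (a + B y) = c - y" using ya by (simp add: algebra_simps)
    finally show ?thesis
      by (simp add: power2_norm_eq_inner algebra_simps inner_commute)
  qed
  \<comment> \<open>\<open>y\<close> is the resolvent of \<open>A + B\<close> at \<open>c\<close>, so \<open>y = c\<close> says that \<open>c\<close> is a zero of \<open>A + B\<close>.\<close>
  have "y = c"
  proof (rule ccontr)
    assume "y \<noteq> c"
    define e where "e = (norm (c - y))\<^sup>2 / 2"
    have e: "e > 0" using \<open>y \<noteq> c\<close> by (simp add: e_def)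
    have "bounded (range (\<lambda>n. X n - y))"
      using bounded_translation[OF bounded, of "- y"] by (simp add: image_image)
    hence "(\<lambda>n. r * ((X n - y) \<bullet> g n)) \<longlonglongrightarrow> r * 0"
      by (intro tendsto_mult_left tendsto_inner_bounded_zero g)
    hence "\<forall>\<^sub>F n in sequentially. r * ((X n - y) \<bullet> g n) < e"
      using e by (auto dest: order_tendstoD(2))
    with c[OF e, of "y - c"]
    have "\<exists>\<^sub>F n in sequentially. r * ((X n - y) \<bullet> g n) < e \<and> (X n - c) \<bullet> (y - c) < e"
      by (rule frequently_eventually_conj)
    then obtain n where "(X n - c) \<bullet> (y - c) < e" "r * ((X n - y) \<bullet> g n) < e"
      using frequently_ex by blast
    thus False using ineq[of n] by (simp add: e_def)
  qed
  hence "a + B c = 0" using ya r(1) by simp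
  hence "- B c \<in> A c" using a \<open>y = c\<close> by (simp add: add_eq_0_iff2)
  thus ?thesis using c by blast
qed

lemma tendsto_le_of_frequently:
  fixes u :: "nat \<Rightarrow> real"
  assumes "u \<longlonglongrightarrow> l" "\<And>e. e > 0 \<Longrightarrow> \<exists>\<^sub>F n in sequentially. u n < b + e"
  shows "l \<le> b"
proof (rule ccontr)
  assume "\<not> l \<le> b"
  hence "\<forall>\<^sub>F n in sequentially. (l + b) / 2 < u n"
    using assms(1) by (intro order_tendstoD(1)) auto
  with assms(2)[of "(l - b) / 2"] \<open>\<not> l \<le> b\<close>
  have "\<exists>\<^sub>F n in sequentially. (l + b) / 2 < u n \<and> u n < b + (l - b) / 2"
    by (intro frequently_eventually_conj) auto
  then obtain n where "u n < b + (l - b) / 2" "(l + b) / 2 < u n"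
    using frequently_ex by blast
  thus False by argo
qed

lemma weakly_converges_to_zero_of_sum:
  fixes A :: "'a::{real_inner, complete_space} \<Rightarrow> 'a set"
  assumes max: "maximally_monotone A" and mono_B: "monotone_operator (\<lambda>z. {B z})"
    and lip: "L-lipschitz_on UNIV B"
    and incl: "\<And>n. g n - B (X n) \<in> A (X n)" and g: "g \<longlonglongrightarrow> 0"
    and ne: "\<exists>p. - B p \<in> A p"
    and conv: "\<And>p. - B p \<in> A p \<Longrightarrow> convergent (\<lambda>n. norm (X n - p))"
  shows "\<exists>p. - B p \<in> A p \<and> weakly_converges_to X p"
proof -
  obtain p where p: "- B p \<in> A p" using ne by blast
  have "Bseq (\<lambda>n. norm (X n - p))" using conv[OF p] by (rule convergent_imp_Bseq)
  then obtain R where R: "\<And>n. norm (X n - p) \<le> R" unfolding Bseq_def by auto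
  have bounded: "bounded (range X)"
    unfolding bounded_iff
  proof (intro exI[of _ "R + norm p"] ballI)
    fix w assume "w \<in> range X"
    thus "norm w \<le> R + norm p" using R norm_triangle_sub[of _ p] by (smt (verit) imageE)
  qed
  obtain c where c: "- B c \<in> A c"
      "\<And>y e. e > 0 \<Longrightarrow> \<exists>\<^sub>F n in sequentially. (X n - c) \<bullet> y < e"
    using zero_cluster_point[OF max mono_B lip incl g bounded] by blast
  have unique: "\<forall>\<^sub>F n in sequentially. (X n - c) \<bullet> y < e" if "e > 0" for y e
  proof (rule ccontr)
    assume "\<not> ?thesis"
    from not_eventually_sequentiallyD[OF this]
    obtain \<phi> :: "nat \<Rightarrow> nat" where \<phi>: "strict_mono \<phi>" "\<And>n. \<not> (X (\<phi> n) - c) \<bullet> y < e"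
      by auto
    have "bounded (range (X \<circ> \<phi>))" using bounded by (rule bounded_subset) auto
    moreover have "g (\<phi> n) - B ((X \<circ> \<phi>) n) \<in> A ((X \<circ> \<phi>) n)" for n
      using incl by simp
    moreover have "(\<lambda>n. g (\<phi> n)) \<longlonglongrightarrow> 0"
      using LIMSEQ_subseq_LIMSEQ[OF g \<phi>(1)] by (simp add: o_def)
    ultimately obtain c' where c': "- B c' \<in> A c'"
        "\<And>y e. e > 0 \<Longrightarrow> \<exists>\<^sub>F n in sequentially. ((X \<circ> \<phi>) n - c') \<bullet> y < e"
      using zero_cluster_point[OF max mono_B lip, of "\<lambda>n. g (\<phi> n)" "X \<circ> \<phi>"] by blast
    obtain a b where ab: "(\<lambda>n. norm (X n - c)) \<longlonglongrightarrow> a" "(\<lambda>n. norm (X n - c')) \<longlonglongrightarrow> b"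
      using conv[OF c(1)] conv[OF c'(1)] by (auto simp: convergent_def)
    have "X n \<bullet> (c - c') = ((norm (X n - c'))\<^sup>2 - (norm (X n - c))\<^sup>2 - c' \<bullet> c' + c \<bullet> c) / 2" for n
      by (simp add: power2_norm_eq_inner algebra_simps inner_commute)
    moreover have "(\<lambda>n. ((norm (X n - c'))\<^sup>2 - (norm (X n - c))\<^sup>2 - c' \<bullet> c' + c \<bullet> c) / 2)
        \<longlonglongrightarrow> (b\<^sup>2 - a\<^sup>2 - c' \<bullet> c' + c \<bullet> c) / 2"
      using ab by (intro tendsto_intros) auto
    ultimately obtain l where l: "(\<lambda>n. X n \<bullet> (c - c')) \<longlonglongrightarrow> l" by auto
    have "(\<lambda>n. X n \<bullet> (c' - c)) \<longlonglongrightarrow> - l"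
      using tendsto_minus[OF l] by (simp add: inner_diff_right)
    hence "- l \<le> c \<bullet> (c' - c)"
      by (rule tendsto_le_of_frequently)
         (use c(2)[of _ "c' - c"] in \<open>simp add: inner_diff_left diff_less_eq add.commute\<close>)
    moreover have "(\<lambda>n. (X \<circ> \<phi>) n \<bullet> (c - c')) \<longlonglongrightarrow> l"
      using LIMSEQ_subseq_LIMSEQ[OF l \<phi>(1)] by (simp add: o_def)
    hence "l \<le> c' \<bullet> (c - c')"
      by (rule tendsto_le_of_frequently)
         (use c'(2)[of _ "c - c'"] in \<open>simp add: inner_diff_left diff_less_eq add.commute\<close>)
    ultimately have "(c - c') \<bullet> (c - c') \<le> 0"
      by (simp add: algebra_simps inner_commute)
    hence "c = c'" using inner_ge_zero[of "c - c'"] by (simp add: order_antisym_conv)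
    obtain n where "((X \<circ> \<phi>) n - c') \<bullet> y < e"
      using frequently_ex[OF c'(2)[OF \<open>e > 0\<close>]] by blast
    thus False using \<phi>(2)[of n] \<open>c = c'\<close> by simp
  qed
  have "(\<lambda>n. X n \<bullet> y) \<longlonglongrightarrow> c \<bullet> y" for y
  proof (rule tendstoI)
    fix e :: real assume e: "e > 0"
    show "\<forall>\<^sub>F n in sequentially. dist (X n \<bullet> y) (c \<bullet> y) < e"
      using eventually_conj[OF unique[OF e, of y] unique[OF e, of "- y"]]
      by eventually_elim (auto simp: dist_real_def inner_diff_left abs_less_iff)
  qed
  thus ?thesis using c(1) unfolding weakly_converges_to_def by blast
qed

subsection \<open>Step sizes\<close>

lemma step_sizes_eventually_regular:
  fixes t D E :: "nat \<Rightarrow> real"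
  assumes t0: "t 0 > 0" and c: "0 < c1" "c1 < c2"
    and \<gamma>: "\<And>n. \<gamma> n \<ge> 0" "summable \<gamma>"
    and L: "L \<ge> 0" and E: "\<And>n. 0 \<le> E n" "\<And>n. E n \<le> L * D n" and D: "\<And>n. 0 \<le> D n"
    and step: "\<And>n. t (Suc n) = (if E n > c2 / t n * D n then c1 * D n / E n else (1 + \<gamma> n) * t n)"
  shows "\<exists>m>0. (\<forall>n. m \<le> t n) \<and> (\<forall>\<^sub>F n in sequentially. t n * E n \<le> c2 * D n)"
proof -
  define m where "m = min (t 0) (c1 / (L + 1))"
  have m: "m > 0" using t0 c L by (simp add: m_def)
  have lower: "m \<le> t n" for n
  proof (induction n)
    case 0
    show ?case by (simp add: m_def)
  next
    case (Suc n)
    hence tn: "t n > 0" using m by linarith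
    show ?case
    proof (cases "E n > c2 / t n * D n")
      case True
      moreover have "0 \<le> c2 / t n * D n" using tn c D by simp
      ultimately have En: "E n > 0" by linarith
      have "D n * L \<le> D n * (L + 1)" using D by (simp add: mult_left_mono)
      hence "E n \<le> D n * (L + 1)" using E(2)[of n] by (simp add: mult.commute)
      hence "c1 * E n \<le> c1 * (D n * (L + 1))" using c by simp
      hence "c1 / (L + 1) \<le> c1 * D n / E n" using En L by (simp add: field_simps)
      thus ?thesis using True by (simp add: step m_def)
    next
      case False
      have "t n * 1 \<le> t n * (1 + \<gamma> n)" using tn \<gamma>(1)[of n] by (intro mult_left_mono) auto
      thus ?thesis using Suc False by (simp add: step mult.commute)
    qed
  qed
  hence tpos: "t n > 0" for n using m by (meson less_le_trans)
  define P where "P n = (\<Prod>i<n. 1 + \<gamma> i)" for n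
  have P1: "1 \<le> P n" for n unfolding P_def using \<gamma>(1) by (intro prod_ge_1) auto
  have PM: "P n \<le> exp (suminf \<gamma>)" for n
  proof -
    have "P n \<le> exp (\<Sum>i<n. \<gamma> i)"
      unfolding P_def exp_sum[OF finite_lessThan] using \<gamma>(1)
      by (intro prod_mono) (auto intro: add_nonneg_nonneg exp_ge_add_one_self)
    also have "\<dots> \<le> exp (suminf \<gamma>)" using \<gamma> by (simp add: sum_le_suminf)
    finally show ?thesis .
  qed
  \<comment> \<open>Dividing by \<open>P n\<close> removes the growth, so that \<open>u\<close> is constant except for drops by the factor \<open>q\<close>.\<close>
  define u where "u n = t n / P n" for n
  define q where "q = c1 / c2"
  have q: "0 < q" "q < 1" using c by (auto simp: q_def)
  have upos: "u n > 0" for n using tpos P1[of n] by (simp add: u_def)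
  have u_bad: "u (Suc n) \<le> q * u n" if "E n > c2 / t n * D n" for n
  proof -
    have En: "E n > 0" using that tpos[of n] c D[of n]
      by (smt (verit) divide_nonneg_pos mult_nonneg_nonneg)
    have "c2 * D n \<le> t n * E n" using that tpos[of n] by (simp add: field_simps)
    hence "c1 * (c2 * D n) \<le> c1 * (t n * E n)" using c by simp
    hence "t (Suc n) \<le> q * t n" using that En c by (simp add: step q_def field_simps)
    hence "t (Suc n) / P (Suc n) \<le> q * t n / P (Suc n)"
      using P1[of "Suc n"] by (intro divide_right_mono) auto
    also have "P n \<le> P (Suc n)"
      using P1[of n] \<gamma>(1)[of n] by (simp add: P_def algebra_simps)
    hence "q * t n / P (Suc n) \<le> q * t n / P n"
      using P1[of n] q tpos[of n] by (intro divide_left_mono) auto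
    finally show ?thesis by (simp add: u_def)
  qed
  have u_good: "u (Suc n) = u n" if "\<not> E n > c2 / t n * D n" for n
  proof -
    have "1 + \<gamma> n \<noteq> 0" using \<gamma>(1)[of n] by linarith
    thus ?thesis using that by (simp add: u_def P_def step)
  qed
  have dec: "decseq u"
  proof (rule decseq_SucI)
    fix n
    have "q * u n \<le> u n" using q upos[of n] by simp
    thus "u (Suc n) \<le> u n" using u_bad[of n] u_good[of n] by fastforce
  qed
  obtain l where l: "u \<longlonglongrightarrow> l" "\<And>n. l \<le> u n"
    using decseq_convergent[OF dec, of 0] upos by (metis less_imp_le)
  have "m / exp (suminf \<gamma>) \<le> u n" for n
    unfolding u_def using lower[of n] PM[of n] P1[of n] m by (intro frac_le) auto
  hence "m / exp (suminf \<gamma>) \<le> l" using l(1) by (intro LIMSEQ_le_const) auto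
  hence lpos: "l > 0" using m by (smt (verit) divide_pos_pos exp_gt_zero)
  hence "l < l / q" using q by (simp add: field_simps)
  hence "\<forall>\<^sub>F n in sequentially. u n < l / q" using l(1) by (rule order_tendstoD(2)[rotated])
  hence "\<forall>\<^sub>F n in sequentially. t n * E n \<le> c2 * D n"
  proof eventually_elim
    case (elim n)
    hence "\<not> u (Suc n) \<le> q * u n" using l(2)[of "Suc n"] q by (simp add: field_simps)
    hence "\<not> E n > c2 / t n * D n" using u_bad by blast
    thus ?case using tpos[of n] by (simp add: field_simps)
  qed
  thus ?thesis using m lower by blast
qed

subsection \<open>The Lyapunov function\<close>

lemma gfrb_lyapunov_descent:
  fixes x0 x1 x2 x3 p :: "'a::real_inner"
  assumes rel: "0 \<le> (x3 - p) \<bullet> ((x2 - x3) - \<alpha> *\<^sub>R (x2 - x1) + (w2 - (1 + \<delta>) *\<^sub>R w1 + \<delta> *\<^sub>R w0))"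
    and \<alpha>: "0 \<le> \<alpha>" and w1: "norm w1 \<le> c * norm (x2 - x1)" and w0: "norm w0 \<le> c * norm (x1 - x0)"
    and c: "0 \<le> c" and small: "2 * c * (1 + \<bar>\<delta>\<bar>) + \<alpha> + \<epsilon> \<le> 1"
  shows "(norm (x3 - p))\<^sup>2 + \<alpha> * (norm (x2 - p))\<^sup>2 - 2 * ((x3 - p) \<bullet> (w2 - \<delta> *\<^sub>R w1))
      + c * (1 + \<bar>\<delta>\<bar>) * (norm (x3 - x2))\<^sup>2 + c * \<bar>\<delta>\<bar> * (norm (x2 - x1))\<^sup>2 + \<epsilon> * (norm (x3 - x2))\<^sup>2
    \<le> (norm (x2 - p))\<^sup>2 + \<alpha> * (norm (x1 - p))\<^sup>2 - 2 * ((x2 - p) \<bullet> (w1 - \<delta> *\<^sub>R w0))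
      + c * (1 + \<bar>\<delta>\<bar>) * (norm (x2 - x1))\<^sup>2 + c * \<bar>\<delta>\<bar> * (norm (x1 - x0))\<^sup>2"
proof -
  define d3 d2 d1 where d: "d3 = norm (x3 - x2)" "d2 = norm (x2 - x1)" "d1 = norm (x1 - x0)"
  have eq: "(norm (x3 - p))\<^sup>2 + \<alpha> * (norm (x2 - p))\<^sup>2 - 2 * ((x3 - p) \<bullet> (w2 - \<delta> *\<^sub>R w1))
      = (norm (x2 - p))\<^sup>2 + \<alpha> * (norm (x1 - p))\<^sup>2 - 2 * ((x2 - p) \<bullet> (w1 - \<delta> *\<^sub>R w0))
        - 2 * ((x3 - p) \<bullet> ((x2 - x3) - \<alpha> *\<^sub>R (x2 - x1) + (w2 - (1 + \<delta>) *\<^sub>R w1 + \<delta> *\<^sub>R w0)))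
        - d3\<^sup>2 - \<alpha> * d2\<^sup>2 - 2 * \<alpha> * ((x3 - x2) \<bullet> (x2 - x1)) - 2 * ((x3 - x2) \<bullet> (w1 - \<delta> *\<^sub>R w0))"
    unfolding d power2_norm_eq_inner by (simp add: algebra_simps inner_commute)
  have "0 \<le> \<alpha> * (norm ((x3 - x2) + (x2 - x1)))\<^sup>2" using \<alpha> by simp
  also have "\<dots> = \<alpha> * d3\<^sup>2 + \<alpha> * d2\<^sup>2 + 2 * \<alpha> * ((x3 - x2) \<bullet> (x2 - x1))"
    unfolding d power2_norm_eq_inner by (simp add: algebra_simps inner_commute)
  finally have inertia: "- \<alpha> * d2\<^sup>2 - 2 * \<alpha> * ((x3 - x2) \<bullet> (x2 - x1)) \<le> \<alpha> * d3\<^sup>2" by linarith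
  have "- ((x3 - x2) \<bullet> (w1 - \<delta> *\<^sub>R w0)) \<le> d3 * norm (w1 - \<delta> *\<^sub>R w0)"
    using Cauchy_Schwarz_ineq2[of "x3 - x2" "w1 - \<delta> *\<^sub>R w0"] unfolding d by linarith
  also have "norm (w1 - \<delta> *\<^sub>R w0) \<le> norm w1 + \<bar>\<delta>\<bar> * norm w0"
    using norm_triangle_ineq4[of w1 "\<delta> *\<^sub>R w0"] by simp
  also have "\<dots> \<le> c * d2 + \<bar>\<delta>\<bar> * (c * d1)"
    using w1 w0 unfolding d by (intro add_mono mult_left_mono) auto
  finally have "- ((x3 - x2) \<bullet> (w1 - \<delta> *\<^sub>R w0)) \<le> d3 * (c * d2 + \<bar>\<delta>\<bar> * (c * d1))"
    by (simp add: d mult_left_mono)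
  hence "- 2 * ((x3 - x2) \<bullet> (w1 - \<delta> *\<^sub>R w0)) \<le> c * (2 * d3 * d2) + c * \<bar>\<delta>\<bar> * (2 * d3 * d1)"
    by (simp add: algebra_simps)
  also have "\<dots> \<le> c * (d3\<^sup>2 + d2\<^sup>2) + c * \<bar>\<delta>\<bar> * (d3\<^sup>2 + d1\<^sup>2)"
    using c by (intro add_mono mult_left_mono sum_squares_bound) auto
  finally have forcing: "- 2 * ((x3 - x2) \<bullet> (w1 - \<delta> *\<^sub>R w0))
      \<le> c * (d3\<^sup>2 + d2\<^sup>2) + c * \<bar>\<delta>\<bar> * (d3\<^sup>2 + d1\<^sup>2)" .
  have "(2 * c * (1 + \<bar>\<delta>\<bar>) + \<alpha> + \<epsilon>) * d3\<^sup>2 \<le> 1 * d3\<^sup>2"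
    using small by (rule mult_right_mono) simp
  thus ?thesis
    using eq inertia forcing rel unfolding d[symmetric] by (simp add: algebra_simps)
qed

lemma gfrb_lyapunov_lower_bound:
  fixes y w1 w0 :: "'a::real_inner"
  assumes "norm w1 \<le> c * d2" "norm w0 \<le> c * d1" "0 \<le> c" "2 * c * (1 + \<bar>\<delta>\<bar>) \<le> 1"
  shows "(norm y)\<^sup>2 / 2 \<le> (norm y)\<^sup>2 - 2 * (y \<bullet> (w1 - \<delta> *\<^sub>R w0))
      + c * (1 + \<bar>\<delta>\<bar>) * d2\<^sup>2 + c * \<bar>\<delta>\<bar> * d1\<^sup>2"
proof -
  have "y \<bullet> (w1 - \<delta> *\<^sub>R w0) \<le> norm y * norm (w1 - \<delta> *\<^sub>R w0)" by (rule norm_cauchy_schwarz)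
  also have "norm (w1 - \<delta> *\<^sub>R w0) \<le> norm w1 + \<bar>\<delta>\<bar> * norm w0"
    using norm_triangle_ineq4[of w1 "\<delta> *\<^sub>R w0"] by simp
  also have "\<dots> \<le> c * d2 + \<bar>\<delta>\<bar> * (c * d1)"
    using assms by (intro add_mono mult_left_mono) auto
  finally have "y \<bullet> (w1 - \<delta> *\<^sub>R w0) \<le> norm y * (c * d2 + \<bar>\<delta>\<bar> * (c * d1))"
    by (simp add: mult_left_mono)
  hence "2 * (y \<bullet> (w1 - \<delta> *\<^sub>R w0)) \<le> c * (2 * norm y * d2) + c * \<bar>\<delta>\<bar> * (2 * norm y * d1)"
    by (simp add: algebra_simps)
  also have "\<dots> \<le> c * ((norm y)\<^sup>2 + d2\<^sup>2) + c * \<bar>\<delta>\<bar> * ((norm y)\<^sup>2 + d1\<^sup>2)"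
    using assms by (intro add_mono mult_left_mono sum_squares_bound) auto
  finally have "2 * (y \<bullet> (w1 - \<delta> *\<^sub>R w0)) \<le> c * ((norm y)\<^sup>2 + d2\<^sup>2) + c * \<bar>\<delta>\<bar> * ((norm y)\<^sup>2 + d1\<^sup>2)" .
  moreover have "(2 * c * (1 + \<bar>\<delta>\<bar>)) * (norm y)\<^sup>2 \<le> 1 * (norm y)\<^sup>2"
    using assms(4) by (rule mult_right_mono) simp
  moreover have "0 \<le> c * \<bar>\<delta>\<bar> * d2\<^sup>2" using assms(3) by simp
  ultimately show ?thesis by (simp add: algebra_simps)
qed

lemma descent_convergent:
  fixes V a :: "nat \<Rightarrow> real"
  assumes "\<And>n. n \<ge> N \<Longrightarrow> V (Suc n) + a n \<le> V n" "\<And>n. a n \<ge> 0" "\<And>n. n \<ge> N \<Longrightarrow> V n \<ge> 0"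
  shows "convergent V" "a \<longlonglongrightarrow> 0"
proof -
  have "decseq (\<lambda>n. V (n + N))"
    using assms(1,2) by (intro decseq_SucI) (metis add_Suc add_increasing2 le_add2 order_trans order_refl)
  then obtain l where l: "(\<lambda>n. V (n + N)) \<longlonglongrightarrow> l"
    by (rule decseq_convergent[of _ 0]) (use assms(3) in auto)
  hence V: "V \<longlonglongrightarrow> l" by (rule LIMSEQ_offset)
  thus "convergent V" by (auto simp: convergent_def)
  show "a \<longlonglongrightarrow> 0"
  proof (rule tendsto_sandwich[of "\<lambda>_. 0" a _ "\<lambda>n. V n - V (Suc n)"])
    show "\<forall>\<^sub>F n in sequentially. a n \<le> V n - V (Suc n)"
      using assms(1) unfolding eventually_sequentially by (intro exI[of _ N]) (smt (verit))
    show "(\<lambda>n. V n - V (Suc n)) \<longlonglongrightarrow> 0"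
      using tendsto_diff[OF V LIMSEQ_Suc[OF V]] by simp
  qed (use assms(2) in auto)
qed

lemma gfrb_quasi_fejer:
  fixes X W :: "nat \<Rightarrow> 'a::real_inner"
  assumes rel: "\<And>n. 0 \<le> (X (n + 3) - p) \<bullet> ((X (n + 2) - X (n + 3)) - \<alpha> *\<^sub>R (X (n + 2) - X (n + 1))
        + (W (n + 2) - (1 + \<delta>) *\<^sub>R W (n + 1) + \<delta> *\<^sub>R W n))"
    and W: "\<forall>\<^sub>F n in sequentially. norm (W n) \<le> c * norm (X (n + 1) - X n)"
    and \<alpha>: "0 \<le> \<alpha>" and c: "0 \<le> c" and \<epsilon>: "0 < \<epsilon>"
    and small: "2 * c * (1 + \<bar>\<delta>\<bar>) + \<alpha> + \<epsilon> \<le> 1"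
  shows "(\<lambda>n. X (n + 1) - X n) \<longlonglongrightarrow> 0" "W \<longlonglongrightarrow> 0" "convergent (\<lambda>n. norm (X n - p))"
proof -
  obtain N where N: "\<And>n. n \<ge> N \<Longrightarrow> norm (W n) \<le> c * norm (X (n + 1) - X n)"
    using W unfolding eventually_sequentially by blast
  define C where "C n = c * (1 + \<bar>\<delta>\<bar>) * (norm (X (n + 2) - X (n + 1)))\<^sup>2
      + c * \<bar>\<delta>\<bar> * (norm (X (n + 1) - X n))\<^sup>2" for n
  define I where "I n = (X (n + 2) - p) \<bullet> (W (n + 1) - \<delta> *\<^sub>R W n)" for n
  define V where "V n = (norm (X (n + 2) - p))\<^sup>2 + \<alpha> * (norm (X (n + 1) - p))\<^sup>2 - 2 * I n + C n" for n
  define a where "a n = \<epsilon> * (norm (X (n + 3) - X (n + 2)))\<^sup>2" for n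
  have V_ge: "(norm (X (n + 2) - p))\<^sup>2 / 2 \<le> V n" if "n \<ge> N" for n
  proof -
    have "(norm (X (n + 2) - p))\<^sup>2 / 2 \<le> (norm (X (n + 2) - p))\<^sup>2 - 2 * I n + C n"
      using gfrb_lyapunov_lower_bound[of "W (n + 1)" c "norm (X (n + 2) - X (n + 1))" "W n"
          "norm (X (n + 1) - X n)" \<delta> "X (n + 2) - p"] N[of n] N[of "n + 1"] that c small \<alpha> \<epsilon>
      by (simp add: I_def C_def)
    moreover have "0 \<le> \<alpha> * (norm (X (n + 1) - p))\<^sup>2" using \<alpha> by simp
    ultimately show ?thesis unfolding V_def by linarith
  qed
  have dec: "V (Suc n) + a n \<le> V n" if "n \<ge> N" for n
    using gfrb_lyapunov_descent[OF rel[of n] \<alpha> _ _ c small, of "X n"] N[of n] N[of "n + 1"] that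
    by (simp add: V_def I_def C_def a_def numeral_2_eq_2 numeral_3_eq_3)
  have a: "a n \<ge> 0" for n using \<epsilon> by (simp add: a_def)
  have V0: "V n \<ge> 0" if "n \<ge> N" for n
    using V_ge[OF that] by (smt (verit) zero_le_power2 divide_nonneg_pos)
  note lims = descent_convergent[of N V a, OF dec a V0]
  have "(\<lambda>n. a n / \<epsilon>) \<longlonglongrightarrow> 0 / \<epsilon>" using lims(2) by (intro tendsto_divide tendsto_const) (use \<epsilon> in auto)
  hence "(\<lambda>n. sqrt ((norm (X (n + 3) - X (n + 2)))\<^sup>2)) \<longlonglongrightarrow> sqrt 0"
    using \<epsilon> by (intro tendsto_real_sqrt) (simp add: a_def)
  hence "(\<lambda>n. X (n + 3) - X (n + 2)) \<longlonglongrightarrow> 0"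
    by (simp add: tendsto_norm_zero_iff)
  thus D: "(\<lambda>n. X (n + 1) - X n) \<longlonglongrightarrow> 0"
    by (intro LIMSEQ_offset[of "\<lambda>n. X (n + 1) - X n" 2]) (simp add: numeral_3_eq_3 numeral_2_eq_2)
  show W0: "W \<longlonglongrightarrow> 0"
    using tendsto_mult_left[OF tendsto_norm_zero[OF D], of c] W
    by (intro Lim_null_comparison[OF W]) simp
  obtain M where M: "\<And>n. V n \<le> M"
    using convergent_imp_Bseq[OF lims(1)] unfolding Bseq_def by (smt (verit) real_norm_def)
  have "norm (X (n + 2 + N) - p) \<le> sqrt (2 * M)" for n
    using V_ge[of "n + N"] M[of "n + N"] by (intro real_le_rsqrt) (simp add: add_ac)
  hence "Bseq (\<lambda>n. X (n + (2 + N)) - p)"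
    by (intro BseqI'[of _ "sqrt (2 * M)"]) (simp add: add_ac)
  hence "Bseq (\<lambda>n. X n - p)" by (rule Bseq_offset[of "\<lambda>n. X n - p"])
  hence bd: "bounded (range (\<lambda>n. X n - p))" by (simp add: Bseq_eq_bounded)
  have "(\<lambda>n. W (n + 1) - \<delta> *\<^sub>R W n) \<longlonglongrightarrow> 0 - \<delta> *\<^sub>R 0"
    using W0 by (intro tendsto_intros LIMSEQ_ignore_initial_segment)
  hence I0: "I \<longlonglongrightarrow> 0"
    unfolding I_def by (intro tendsto_inner_bounded_zero bounded_subset[OF bd]) auto
  have "C \<longlonglongrightarrow> c * (1 + \<bar>\<delta>\<bar>) * (norm (0::'a))\<^sup>2 + c * \<bar>\<delta>\<bar> * (norm (0::'a))\<^sup>2"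
    unfolding C_def
    using LIMSEQ_ignore_initial_segment[OF D, of 1] D by (intro tendsto_intros) (simp_all add: numeral_2_eq_2)
  hence C0: "C \<longlonglongrightarrow> 0" by simp
  obtain l where l: "V \<longlonglongrightarrow> l" using lims(1) by (auto simp: convergent_def)
  define \<Delta> where "\<Delta> n = (X (n + 2) - p + (X (n + 1) - p)) \<bullet> (X (n + 2) - X (n + 1))" for n
  have "bounded (range (\<lambda>n. X (n + 2) - p + (X (n + 1) - p)))"
    by (rule bounded_subset[OF bounded_plus[OF bd bd]]) auto
  hence \<Delta>0: "\<Delta> \<longlonglongrightarrow> 0"
    unfolding \<Delta>_def using LIMSEQ_ignore_initial_segment[OF D, of 1]
    by (intro tendsto_inner_bounded_zero) (simp_all add: numeral_2_eq_2)
  have "(norm (X (n + 2) - p))\<^sup>2 = (V n + 2 * I n - C n + \<alpha> * \<Delta> n) / (1 + \<alpha>)" for n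
  proof -
    have \<Delta>_eq: "\<Delta> n = (norm (X (n + 2) - p))\<^sup>2 - (norm (X (n + 1) - p))\<^sup>2"
      unfolding \<Delta>_def power2_norm_eq_inner by (simp add: algebra_simps inner_commute)
    have "V n + 2 * I n - C n + \<alpha> * \<Delta> n = (norm (X (n + 2) - p))\<^sup>2 * (1 + \<alpha>)"
      unfolding V_def \<Delta>_eq by (simp add: algebra_simps)
    thus ?thesis using \<alpha> by (simp add: eq_divide_eq)
  qed
  hence "(\<lambda>n. norm (X (n + 2) - p)) = (\<lambda>n. sqrt ((V n + 2 * I n - C n + \<alpha> * \<Delta> n) / (1 + \<alpha>)))"
    by (metis norm_ge_zero real_sqrt_unique)
  also have "\<dots> \<longlonglongrightarrow> sqrt ((l + 2 * 0 - 0 + \<alpha> * 0) / (1 + \<alpha>))"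
    using l I0 C0 \<Delta>0 \<alpha> by (intro tendsto_intros) auto
  finally show "convergent (\<lambda>n. norm (X n - p))"
    using LIMSEQ_offset[of "\<lambda>n. norm (X n - p)" 2] by (auto simp: convergent_def)
qed

subsection \<open>Convergence of the algorithm\<close>

lemma zero_of_sum_iff:
  fixes A :: "'a::real_inner \<Rightarrow> 'a set"
  shows "p \<in> operator_inverse (operator_sum A (\<lambda>z. {B z})) 0 \<longleftrightarrow> - B p \<in> A p"
  by (auto simp: operator_inverse_def operator_sum_def add_eq_0_iff2)

theorem theorem3p3:
  fixes A :: "'a::{real_inner, complete_space} \<Rightarrow> 'a set"
    and B :: "'a \<Rightarrow> 'a"
    and L \<alpha> \<delta> \<epsilon> c1 c2 :: real
    and \<gamma> :: "nat \<Rightarrow> real"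
    and x :: "int \<Rightarrow> 'a"
    and s :: "int \<Rightarrow> real"
  assumes "maximally_monotone A"
    and "monotone_operator (\<lambda>z. {B z})"
    and "L-lipschitz_on UNIV B"
    and "operator_inverse (operator_sum A (\<lambda>z. {B z})) 0 \<noteq> {}"
    and "0 \<le> \<alpha>" and "\<alpha> < 1"
    and "\<epsilon> > 0"
    and "0 < c1" and "c1 < c2" and "c2 < (1 - \<epsilon> - \<alpha>) / (2 * \<bar>\<delta>\<bar> + 2)"
    and "s (-1) > 0" and "s 0 > 0"
    and "\<And>k. \<gamma> k \<ge> 0" and "summable \<gamma>"
    and "gfrb_step_sizes B c1 c2 \<gamma> x s"
    and "gfrb_iterates A B \<alpha> \<delta> x s"
  shows "\<exists>p \<in> operator_inverse (operator_sum A (\<lambda>z. {B z})) 0.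
           weakly_converges_to (\<lambda>n. x (int n)) p"
proof -
  note max = assms(1) and mono_B = assms(2) and lip = assms(3)
  \<comment> \<open>\<open>X 0\<close> is \<open>x (- 1)\<close>, whereas \<open>t 0\<close> is \<open>s 0\<close>.\<close>
  define X where "X n = x (int n - 1)" for n
  define t where "t n = s (int n)" for n
  define W where "W n = s (int n - 1) *\<^sub>R (B (X (n + 1)) - B (X n))" for n
  define D where "D n = norm (X (n + 1) - X (n + 2))" for n
  define E where "E n = norm (B (X (n + 1)) - B (X (n + 2)))" for n
  have x_X: "x (int n) = X (n + 1)" "x (int n + 1) = X (n + 2)" "x (2 + int n) = X (n + 3)"
      "x (int n - 1) = X n" for n
    by (simp_all add: X_def add.commute)
  have s_t: "s (int n + 1) = t (n + 1)" for n by (simp add: t_def add.commute)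
  have E_le: "E n \<le> L * D n" for n
    using lipschitz_onD[OF lip, of "X (n + 1)" "X (n + 2)"] by (simp add: E_def D_def dist_norm)
  have step: "t (Suc n) = (if E n > c2 / t n * D n then c1 * D n / E n else (1 + \<gamma> n) * t n)" for n
    using assms(15)[unfolded gfrb_step_sizes_def, rule_format, of "int n + 1"]
    by (simp add: x_X s_t E_def D_def flip: t_def)
  obtain m where m: "m > 0" "\<And>n. m \<le> t n"
      and reg: "\<forall>\<^sub>F n in sequentially. t n * E n \<le> c2 * D n"
    using step_sizes_eventually_regular[of t c1 c2 \<gamma> L E D, OF _ assms(8,9,13,14)
        lipschitz_on_nonneg[OF lip] _ E_le _ step] assms(12)
    by (auto simp: t_def E_def D_def)
  have t_pos: "t n > 0" for n using m by (meson less_le_trans)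
  define R where "R n = (X (n + 2) - X (n + 3)) - \<alpha> *\<^sub>R (X (n + 2) - X (n + 1))
        + (W (n + 2) - (1 + \<delta>) *\<^sub>R W (n + 1) + \<delta> *\<^sub>R W n)" for n
  have W2: "W (n + 2) = t (n + 1) *\<^sub>R (B (X (n + 3)) - B (X (n + 2)))"
    and W1: "W (n + 1) = t n *\<^sub>R (B (X (n + 2)) - B (X (n + 1)))" for n
    using s_t[of n] by (simp_all add: W_def t_def numeral_3_eq_3 numeral_2_eq_2)
  have "\<exists>g. g - B (X (n + 3)) \<in> A (X (n + 3)) \<and> t (n + 1) *\<^sub>R g = R n" for n
  proof -
    define z where "z = (1 - \<alpha>) *\<^sub>R X (n + 2) + \<alpha> *\<^sub>R X (n + 1) - t (n + 1) *\<^sub>R B (X (n + 2))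
        - (1 + \<delta>) *\<^sub>R W (n + 1) + \<delta> *\<^sub>R W n"
    have "X (n + 3) = resolvent (operator_scale (t (n + 1)) A) z"
      using assms(16)[unfolded gfrb_iterates_def, rule_format, of "int n + 1"]
      unfolding z_def W1 by (simp add: x_X s_t W_def mult.commute flip: t_def)
    then obtain a where a: "a \<in> A (X (n + 3))" "X (n + 3) + t (n + 1) *\<^sub>R a = z"
      using resolvent_scale[OF max t_pos[of "n + 1"], of z] by auto
    have "t (n + 1) *\<^sub>R (a + B (X (n + 3))) = z - X (n + 3) + t (n + 1) *\<^sub>R B (X (n + 3))"
      using a(2) by (simp add: algebra_simps)
    also have "\<dots> = R n"
      unfolding z_def R_def W2 by (simp add: algebra_simps)
    finally show ?thesis using a(1) by (intro exI[of _ "a + B (X (n + 3))"]) simp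
  qed
  then obtain g where g: "\<And>n. g n - B (X (n + 3)) \<in> A (X (n + 3))"
      "\<And>n. t (n + 1) *\<^sub>R g n = R n"
    by metis
  have rel: "0 \<le> (X (n + 3) - p) \<bullet> R n" if p: "- B p \<in> A p" for p n
  proof -
    have "0 \<le> (X (n + 3) - p) \<bullet> (g n - B (X (n + 3)) - - B p)"
      using max g(1)[of n] p unfolding maximally_monotone_def monotone_operator_def by blast
    moreover have "0 \<le> (X (n + 3) - p) \<bullet> (B (X (n + 3)) - B p)"
      using mono_B unfolding monotone_operator_def by blast
    ultimately have "0 \<le> (X (n + 3) - p) \<bullet> g n" by (simp add: algebra_simps)
    hence "0 \<le> t (n + 1) * ((X (n + 3) - p) \<bullet> g n)" using t_pos[of "n + 1"] by simp
    thus ?thesis by (simp flip: g(2))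
  qed
  have "\<forall>\<^sub>F n in sequentially. norm (W (Suc n)) \<le> c2 * norm (X (Suc n + 1) - X (Suc n))"
    using reg
  proof eventually_elim
    case (elim n)
    thus ?case using W1[of n] t_pos[of n]
      by (simp add: E_def D_def norm_minus_commute numeral_2_eq_2)
  qed
  hence W_le: "\<forall>\<^sub>F n in sequentially. norm (W n) \<le> c2 * norm (X (n + 1) - X n)"
    using eventually_sequentially_Suc[of "\<lambda>n. norm (W n) \<le> c2 * norm (X (n + 1) - X n)"] by blast
  have small: "2 * c2 * (1 + \<bar>\<delta>\<bar>) + \<alpha> + \<epsilon> \<le> 1"
    using assms(10) by (simp add: pos_less_divide_eq algebra_simps)
  have c2: "0 \<le> c2" using assms(8,9) by simp
  note fejer = gfrb_quasi_fejer[OF rel[unfolded R_def] W_le assms(5) c2 assms(7) small]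
  obtain p0 where p0: "- B p0 \<in> A p0" using assms(4) by (auto simp: zero_of_sum_iff)
  note D0 = fejer(1)[OF p0] and W0 = fejer(2)[OF p0]
  have "R \<longlonglongrightarrow> 0"
  proof -
    have "(\<lambda>n. - (X (n + 3) - X (n + 2)) - \<alpha> *\<^sub>R (X (n + 2) - X (n + 1))
        + (W (n + 2) - (1 + \<delta>) *\<^sub>R W (n + 1) + \<delta> *\<^sub>R W n))
        \<longlonglongrightarrow> - 0 - \<alpha> *\<^sub>R 0 + (0 - (1 + \<delta>) *\<^sub>R 0 + \<delta> *\<^sub>R 0)"
      using LIMSEQ_ignore_initial_segment[OF D0, of 2] LIMSEQ_ignore_initial_segment[OF D0, of 1]
      by (intro tendsto_intros LIMSEQ_ignore_initial_segment W0)
         (simp_all add: numeral_3_eq_3 numeral_2_eq_2)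
    thus ?thesis by (simp add: R_def[abs_def])
  qed
  have "g \<longlonglongrightarrow> 0"
  proof (rule Lim_null_comparison)
    have "m * norm (g n) \<le> t (n + 1) * norm (g n)" for n
      using m(2) by (intro mult_right_mono) auto
    also have "t (n + 1) * norm (g n) = norm (R n)" for n
      using t_pos[of "n + 1"] by (simp flip: g(2))
    finally show "\<forall>\<^sub>F n in sequentially. norm (g n) \<le> norm (R n) / m"
      using m(1) by (simp add: field_simps)
    show "(\<lambda>n. norm (R n) / m) \<longlonglongrightarrow> 0"
      using tendsto_divide[OF tendsto_norm_zero[OF \<open>R \<longlonglongrightarrow> 0\<close>] tendsto_const, of m] m(1) by simp
  qed
  then obtain p where p: "- B p \<in> A p" "weakly_converges_to (\<lambda>n. X (n + 3)) p"
    using weakly_converges_to_zero_of_sum[OF max mono_B lip, of g "\<lambda>n. X (n + 3)"] g(1) p0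
      convergent_ignore_initial_segment[of "\<lambda>n. norm (X n - p)" 3 for p] fejer(3)
    by blast
  have "(\<lambda>n. x (int n) \<bullet> y) \<longlonglongrightarrow> p \<bullet> y" for y
    using p(2) unfolding weakly_converges_to_def
    by (intro LIMSEQ_offset[of "\<lambda>n. x (int n) \<bullet> y" 2]) (simp add: X_def)
  thus ?thesis using p(1)
    by (intro bexI[of _ p]) (simp_all add: weakly_converges_to_def zero_of_sum_iff)
qed

end
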